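(* Let $\mathcal A=(S,E,\ell,s_0,d,(g_i)_{i\in S})$ be a destination-complete symbolic DLSL system with dwell over a finite input alphabet $\Omega$, in which every visible state is reachable and admits a realizable non-self departure (for every $i\in S$ there are $j\in\mathrm{Out}(i)\setminus\{i\}$ and $b\in\Omega$ with $g_i(b)=\ell(j)$). Then the phase-expanded realization of $\mathcal A$ has the minimum number of control states among all deterministic graph-respecting labeled transducers for $(S,E)$ equivalent to $\mathcal A$. In particular, over all such transducers with control-state set $Q$, $$\min|Q|=\sum_{i\in S}d_i .$$
   Context: Visible graph. $S$ is a finite set (visible states), $E\subseteq S\times S$, $\mathrm{Out}(i)=\{j\in S:(i,j)\in E\}$. A labeling $\ell:S\to\Sigma$ into a finite alphabet makes the graph destination-labeled: edge $(i,j)$ carries label $\ell(j)$. The graph is self-looping if $(i,i)\in E$ for all $i$. It is label-deterministic if for every $i\in S$, $a\in\Sigma$ there is at most one $j\in\mathrm{Out}(i)$ with $\ell(j)=a$. Put $\Sigma_i=\{\ell(j):j\in\mathrm{Out}(i)\}$ and, for $a\in\Sigma_i$, let $\delta(i,a)$ be the unique $j\in\mathrm{Out}(i)$ with $\ell(j)=a$. A symbolic DLSL system with dwell is $\mathcal A=(S,E,\ell,s_0,d,(g_i)_{i\in S})$ where $(S,E,\ell)$ is destination-labeled, self-looping and label-deterministic, $s_0\in S$, $d:S\to\mathbb N_{\ge1}$, $i\mapsto d_i$, and $g_i:\Omega\to\Sigma_i$ for each $i$. Its operational states are pairs $(i,r)$, $0\le r\le d_i-1$, updated on input $u\in\Omega$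 by $(i,r)\mapsto(i,r-1)$ if $r>0$, and $(i,0)\mapsto(j,d_j-1)$ with $j=\delta(i,g_i(u))$. Starting from $(y_0,r_0)=(s_0,d_{s_0}-1)$ and reading $w=u_1\cdots u_n$ one obtains $(y_1,r_1),\dots,(y_n,r_n)$, and $\mathrm{Out}_{\mathcal A}(w):=y_1\cdots y_n$. The system is destination-complete if for every $i\in S$ and $a\in\Sigma_i$ there is $u\in\Omega$ with $g_i(u)=a$. A visible state is reachable if it is reached from $s_0$ by some input word. Phase-expanded realization of $\mathcal A$: the transducer with control states $\{(i,r):i\in S,\ 0\le r\le d_i-1\}$, initial state $(s_0,d_{s_0}-1)$, transitions given by the operational update, visible labeling $\lambda(i,r)=i$. A graph-respecting labeled transducer for $(S,E)$ is a deterministic transducer $T=(Q,q_0,\Omega,S,\Delta,\lambda)$ with $\Delta:Q\times\Omega\to Q$, $\lambda:Q\to S$ surjective, and $\lambda(\Delta(q,u))\in\mathrm{Out}(\lambda(q))$ for all $q\in Q,u\in\Omega$. Its emitted symbol after reading one input is the visible label $\lambda$ of the successor control state. $T$ is equivalent to $\mathcal A$ if for every $w\in\Omega^*$ the output word emitted by $T$ from $q_0$ equals $\mathrm{Out}_{\mathcal A}(w)$. *)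

theory Defs
  imports Main "HOL-Library.Extended_Nat"
begin

record ('s, 'a) visible_graph =
  vstates :: "'s set"
  edges :: "('s \<times> 's) set"
  alphabet :: "'a set"
  label :: "'s \<Rightarrow> 'a"

definition Out :: "('s, 'a, 'm) visible_graph_scheme \<Rightarrow> 's \<Rightarrow> 's set" where
  "Out G i = {j \<in> vstates G. (i, j) \<in> edges G}"

definition out_labels :: "('s, 'a, 'm) visible_graph_scheme \<Rightarrow> 's \<Rightarrow> 'a set" where
  "out_labels G i = label G ` Out G i"

definition destination_labeled :: "('s, 'a, 'm) visible_graph_scheme \<Rightarrow> bool" where
  "destination_labeled G \<longleftrightarrow>
     finite (vstates G) \<and> edges G \<subseteq> vstates G \<times> vstates G \<and>
     finite (alphabet G) \<and> label G ` vstates G \<subseteq> alphabet G"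

definition self_looping :: "('s, 'a, 'm) visible_graph_scheme \<Rightarrow> bool" where
  "self_looping G \<longleftrightarrow> (\<forall>i \<in> vstates G. (i, i) \<in> edges G)"

definition label_deterministic :: "('s, 'a, 'm) visible_graph_scheme \<Rightarrow> bool" where
  "label_deterministic G \<longleftrightarrow>
     (\<forall>i \<in> vstates G. \<forall>a \<in> alphabet G.
        \<forall>j \<in> Out G i. \<forall>k \<in> Out G i. label G j = a \<and> label G k = a \<longrightarrow> j = k)"

text \<open>Only meaningful for \<open>a \<in> out_labels G i\<close> in a label-deterministic graph.\<close>

definition dest :: "('s, 'a, 'm) visible_graph_scheme \<Rightarrow> 's \<Rightarrow> 'a \<Rightarrow> 's" where
  "dest G i a = (THE j. j \<in> Out G i \<and> label G j = a)"

record ('s, 'a, 'u) dlsl = "('s, 'a) visible_graph" +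
  inputs :: "'u set"
  init_state :: 's
  dwell :: "'s \<Rightarrow> nat"
  guard :: "'s \<Rightarrow> 'u \<Rightarrow> 'a"

definition dlsl_system :: "('s, 'a, 'u) dlsl \<Rightarrow> bool" where
  "dlsl_system A \<longleftrightarrow>
     destination_labeled A \<and> self_looping A \<and> label_deterministic A \<and>
     init_state A \<in> vstates A \<and>
     (\<forall>i \<in> vstates A. 1 \<le> dwell A i) \<and>
     (\<forall>i \<in> vstates A. \<forall>u \<in> inputs A. guard A i u \<in> out_labels A i)"

fun step :: "('s, 'a, 'u) dlsl \<Rightarrow> 's \<times> nat \<Rightarrow> 'u \<Rightarrow> 's \<times> nat" where
  "step A (i, r) u =
     (if r > 0 then (i, r - 1)
      else let j = dest A i (guard A i u) in (j, dwell A j - 1))"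

definition init_op :: "('s, 'a, 'u) dlsl \<Rightarrow> 's \<times> nat" where
  "init_op A = (init_state A, dwell A (init_state A) - 1)"

primrec visible_outputs :: "('s, 'a, 'u) dlsl \<Rightarrow> 's \<times> nat \<Rightarrow> 'u list \<Rightarrow> 's list" where
  "visible_outputs A p [] = []"
| "visible_outputs A p (u # w) = fst (step A p u) # visible_outputs A (step A p u) w"

definition output_word :: "('s, 'a, 'u) dlsl \<Rightarrow> 'u list \<Rightarrow> 's list" where
  "output_word A w = visible_outputs A (init_op A) w"

definition destination_complete :: "('s, 'a, 'u) dlsl \<Rightarrow> bool" where
  "destination_complete A \<longleftrightarrow>
     (\<forall>i \<in> vstates A. \<forall>a \<in> out_labels A i. \<exists>u \<in> inputs A. guard A i u = a)"

definition reachable :: "('s, 'a, 'u) dlsl \<Rightarrow> 's \<Rightarrow> bool" where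
  "reachable A i \<longleftrightarrow> (\<exists>w \<in> lists (inputs A). fst (foldl (step A) (init_op A) w) = i)"

record ('q, 'u, 's) transducer =
  control :: "'q set"
  start :: 'q
  trans_fun :: "'q \<Rightarrow> 'u \<Rightarrow> 'q"
  vlabel :: "'q \<Rightarrow> 's"

primrec emitted :: "('q, 'u, 's) transducer \<Rightarrow> 'q \<Rightarrow> 'u list \<Rightarrow> 's list" where
  "emitted T q [] = []"
| "emitted T q (u # w) = vlabel T (trans_fun T q u) # emitted T (trans_fun T q u) w"

definition graph_respecting ::
  "('s, 'a, 'm) visible_graph_scheme \<Rightarrow> 'u set \<Rightarrow> ('q, 'u, 's) transducer \<Rightarrow> bool" where
  "graph_respecting G \<Omega> T \<longleftrightarrow>
     start T \<in> control T \<and>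
     (\<forall>q \<in> control T. \<forall>u \<in> \<Omega>. trans_fun T q u \<in> control T) \<and>
     vlabel T ` control T = vstates G \<and>
     (\<forall>q \<in> control T. \<forall>u \<in> \<Omega>. vlabel T (trans_fun T q u) \<in> Out G (vlabel T q))"

definition equivalent_to :: "('q, 'u, 's) transducer \<Rightarrow> ('s, 'a, 'u) dlsl \<Rightarrow> bool" where
  "equivalent_to T A \<longleftrightarrow>
     (\<forall>w \<in> lists (inputs A). emitted T (start T) w = output_word A w)"

definition realizes :: "('q, 'u, 's) transducer \<Rightarrow> ('s, 'a, 'u) dlsl \<Rightarrow> bool" where
  "realizes T A \<longleftrightarrow> graph_respecting A (inputs A) T \<and> equivalent_to T A"

text \<open>Transducers may have infinitely many control states, so the count is extended
  (plain \<open>card\<close> would assign 0 to infinite control sets).\<close>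

definition num_control :: "('q, 'u, 's) transducer \<Rightarrow> enat" where
  "num_control T = (if finite (control T) then enat (card (control T)) else \<infinity>)"

definition phase_expanded :: "('s, 'a, 'u) dlsl \<Rightarrow> ('s \<times> nat, 'u, 's) transducer" where
  "phase_expanded A =
     \<lparr> control = {(i, r). i \<in> vstates A \<and> r \<le> dwell A i - 1},
       start = init_op A,
       trans_fun = step A,
       vlabel = fst \<rparr>"

text \<open>The minimum of \<open>|Q|\<close>. HOL cannot quantify over types inside a term, so the control
  states are drawn from the fixed infinite type \<open>'s \<times> nat\<close>; every finite control set embeds
  into it, so no value of \<open>|Q|\<close> that is relevant to the minimum is lost.\<close>

definition min_control :: "('s, 'a, 'u) dlsl \<Rightarrow> enat" where
  "min_control A =
     (LEAST n. \<exists>T :: ('s \<times> nat, 'u, 's) transducer. realizes T A \<and> num_control T = n)"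

end

(* Self-loops together with destination-completeness let every operational state (i, r) be reached
   by a nonempty word: arrive at i, count down to phase 0, take the self-loop, count down to r.
   Along nonempty words an equivalent transducer shows the current visible state as the label of its
   control state, even though the label of its start state is never emitted. Two phases r < r' of
   the same i are separated by r + 1 copies of a departing input. Hence distinct operational states
   need distinct control states. *)

theory Submission
  imports Defs
begin

lemma emitted_snoc:
  "emitted T q (w @ [u]) = emitted T q w @ [vlabel T (foldl (trans_fun T) q (w @ [u]))]"
  by (induction w arbitrary: q) auto

lemma visible_outputs_snoc:
  "visible_outputs A p (w @ [u]) = visible_outputs A p w @ [fst (foldl (step A) p (w @ [u]))]"
  by (induction w arbitrary: p) auto

text \<open>Compare the last letters of the two output words. On the empty word both outputs are
  empty, which leaves the label of \<open>start T\<close> unconstrained.\<close>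

lemma equivalent_to_vlabel:
  assumes "equivalent_to T A" "w \<in> lists (inputs A)" "w \<noteq> []"
  shows "vlabel T (foldl (trans_fun T) (start T) w) = fst (foldl (step A) (init_op A) w)"
proof -
  obtain v u where w: "w = v @ [u]"
    using assms(3) by (metis rev_exhaust)
  have "emitted T (start T) w = visible_outputs A (init_op A) w"
    using assms(1,2) by (simp add: equivalent_to_def output_word_def)
  then show ?thesis
    unfolding w emitted_snoc visible_outputs_snoc by simp
qed

lemma graph_respecting_run_in_control:
  assumes "graph_respecting G \<Omega> T" "w \<in> lists \<Omega>" "q \<in> control T"
  shows "foldl (trans_fun T) q w \<in> control T"
  using assms(2,3)
proof (induction w arbitrary: q)
  case (Cons u w)
  then show ?case
    using assms(1) by (simp add: graph_respecting_def)
qed simp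

lemma foldl_step_countdown:
  "k \<le> r \<Longrightarrow> foldl (step A) (i, r) (replicate k b) = (i, r - k)"
  by (induction k arbitrary: r) auto

lemma dest_label:
  assumes "dlsl_system A" "i \<in> vstates A" "j \<in> Out A i"
  shows "dest A i (label A j) = j"
proof -
  \<comment> \<open>\<open>label_deterministic\<close> gives uniqueness only for letters of
    \<open>alphabet A\<close>.\<close>
  have "label A j \<in> alphabet A"
    using assms by (auto simp: dlsl_system_def destination_labeled_def Out_def)
  then show ?thesis
    using assms unfolding dest_def dlsl_system_def label_deterministic_def
    by (intro the_equality) auto
qed

lemma dest_guard_in_Out:
  assumes "dlsl_system A" "i \<in> vstates A" "u \<in> inputs A"
  shows "dest A i (guard A i u) \<in> Out A i"
proof -
  have "guard A i u \<in> out_labels A i"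
    using assms by (simp add: dlsl_system_def)
  then show ?thesis
    using dest_label[OF assms(1,2)] by (auto simp: out_labels_def)
qed

lemma self_in_Out:
  assumes "dlsl_system A" "i \<in> vstates A"
  shows "i \<in> Out A i"
  using assms by (simp add: dlsl_system_def self_looping_def Out_def)

lemma realizes_phase_expanded:
  assumes "dlsl_system A"
  shows "realizes (phase_expanded A) A"
proof -
  have "emitted (phase_expanded A) p w = visible_outputs A p w" for p w
    by (induction w arbitrary: p) (simp_all add: phase_expanded_def)
  then have equiv: "equivalent_to (phase_expanded A) A"
    by (simp add: equivalent_to_def output_word_def phase_expanded_def)
  have init: "init_op A \<in> control (phase_expanded A)"
    using assms by (simp add: phase_expanded_def init_op_def dlsl_system_def)
  have labels: "fst ` control (phase_expanded A) = vstates A"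
    by (force simp: phase_expanded_def)
  \<comment> \<open>A countdown step repeats the visible state, so the edge it needs is the
    self-loop; a step at phase 0 follows the edge chosen by the guard.\<close>
  have step: "step A (i, r) u \<in> control (phase_expanded A) \<and> fst (step A (i, r) u) \<in> Out A i"
    if "i \<in> vstates A" "r \<le> dwell A i - 1" "u \<in> inputs A" for i r u
    using that dest_guard_in_Out[OF assms that(1,3)] self_in_Out[OF assms that(1)]
    by (auto simp: phase_expanded_def Let_def Out_def)
  show ?thesis
    unfolding realizes_def graph_respecting_def
    using equiv init labels step by (auto simp: phase_expanded_def simp del: step.simps)
qed

lemma num_control_phase_expanded:
  assumes "dlsl_system A"
  shows "num_control (phase_expanded A) = enat (\<Sum>i \<in> vstates A. dwell A i)"
proof -
  have fin: "finite (vstates A)" and pos: "\<And>i. i \<in> vstates A \<Longrightarrow> 1 \<le> dwell A i"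
    using assms by (auto simp: dlsl_system_def destination_labeled_def)
  \<comment> \<open>With truncated subtraction, \<open>r \<le> dwell A i - 1\<close> means
    \<open>r < dwell A i\<close> only because the dwell is at least 1.\<close>
  have ctrl: "control (phase_expanded A) = Sigma (vstates A) (\<lambda>i. {..<dwell A i})"
    using pos by (fastforce simp: phase_expanded_def)
  show ?thesis
    unfolding num_control_def ctrl using fin by (simp add: card_SigmaI)
qed

lemma phase_reachable_nonempty:
  assumes "dlsl_system A" "destination_complete A" "i \<in> vstates A" "reachable A i"
    and "r \<le> dwell A i - 1"
  shows "\<exists>w \<in> lists (inputs A). w \<noteq> [] \<and> foldl (step A) (init_op A) w = (i, r)"
proof -
  obtain v s where v: "v \<in> lists (inputs A)" "foldl (step A) (init_op A) v = (i, s)"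
    using assms(4) by (metis reachable_def prod.collapse)
  have self: "i \<in> Out A i"
    using self_in_Out assms(1,3) .
  then obtain a where a: "a \<in> inputs A" "guard A i a = label A i"
    using assms(2,3) by (auto simp: destination_complete_def out_labels_def)
  have loop: "step A (i, 0) a = (i, dwell A i - 1)"
    using dest_label[OF assms(1,3) self] a(2) by (simp add: Let_def)
  \<comment> \<open>Reachability fixes only the visible state, so the arrival phase \<open>s\<close>
    is arbitrary. Countdown ignores its input, so \<open>a\<close> can serve throughout; the middle
    \<open>[a]\<close> resets the phase to \<open>dwell A i - 1\<close> and makes the word nonempty
    even if \<open>v\<close> is empty.\<close>
  let ?w = "v @ replicate s a @ [a] @ replicate (dwell A i - 1 - r) a"
  have "foldl (step A) (init_op A) ?w = (i, r)"
    using assms(5) v(2) loop by (simp add: foldl_step_countdown del: step.simps)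
  moreover have "?w \<in> lists (inputs A)" "?w \<noteq> []"
    using v(1) a(1) by auto
  ultimately show ?thesis
    by (intro bexI[of _ ?w] conjI)
qed

text \<open>From phase \<open>r\<close>, the first \<open>r\<close> letters are spent on the
  countdown and the last one departs to \<open>j\<close>. From \<open>r' > r\<close>, all
  \<open>r + 1\<close> letters are spent on the countdown, so \<open>i\<close> is still
  visible.\<close>

lemma phases_separated:
  assumes "dlsl_system A" "i \<in> vstates A" "j \<in> Out A i - {i}" "guard A i b = label A j" "r < r'"
  shows "fst (foldl (step A) (i, r) (replicate (Suc r) b))
           \<noteq> fst (foldl (step A) (i, r') (replicate (Suc r) b))"
proof -
  have "replicate (Suc r) b = replicate r b @ [b]"
    by (simp add: replicate_append_same)
  then have "foldl (step A) (i, r) (replicate (Suc r) b) = step A (i, 0) b"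
    by (simp add: foldl_step_countdown del: step.simps replicate_Suc)
  moreover have "fst (step A (i, 0) b) = j"
    using dest_label[OF assms(1,2)] assms(3,4) by (simp add: Let_def)
  moreover have "foldl (step A) (i, r') (replicate (Suc r) b) = (i, r' - Suc r)"
    using assms(5) by (intro foldl_step_countdown) simp
  ultimately show ?thesis
    using assms(3) by auto
qed

lemma num_control_phase_expanded_le:
  assumes sys: "dlsl_system A" and complete: "destination_complete A"
    and reach: "\<forall>i \<in> vstates A. reachable A i"
    and depart: "\<forall>i \<in> vstates A. \<exists>j \<in> Out A i - {i}. \<exists>b \<in> inputs A. guard A i b = label A j"
    and T: "realizes T A"
  shows "num_control (phase_expanded A) \<le> num_control T"
\<comment> \<open>An infinite control set counts as \<infinity>, so only the finite case has
  content.\<close>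
proof (cases "finite (control T)")
  case True
  let ?P = "control (phase_expanded A)"
  let ?run = "foldl (trans_fun T) (start T)"
  let ?op = "foldl (step A) (init_op A)"
  have gr: "graph_respecting A (inputs A) T" and eq: "equivalent_to T A"
    using T by (simp_all add: realizes_def)
  have "\<forall>p \<in> ?P. \<exists>w. w \<in> lists (inputs A) \<and> w \<noteq> [] \<and> ?op w = p"
    using phase_reachable_nonempty[OF sys complete] reach
    by (fastforce simp: phase_expanded_def)
  then obtain W where W: "\<And>p. p \<in> ?P \<Longrightarrow> W p \<in> lists (inputs A)"
      "\<And>p. p \<in> ?P \<Longrightarrow> W p \<noteq> []" "\<And>p. p \<in> ?P \<Longrightarrow> ?op (W p) = p"
    by metis
  \<comment> \<open>After the access word \<open>W p\<close>, the labels shown by \<open>T\<close>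
    are those of \<open>A\<close> started in \<open>p\<close>. The continuation \<open>x\<close> may
    be empty because \<open>W p\<close> is not; this case recovers the visible component of
    \<open>p\<close>.\<close>
  have labels: "vlabel T (foldl (trans_fun T) (?run (W p)) x) = fst (foldl (step A) p x)"
    if "p \<in> ?P" "x \<in> lists (inputs A)" for p x
    using equivalent_to_vlabel[OF eq, of "W p @ x"] W that by simp
  have same_visible: "i = i'"
    if "(i, r) \<in> ?P" "(i', r') \<in> ?P" "?run (W (i, r)) = ?run (W (i', r'))" for i r i' r'
    using labels[OF that(1), of "[]"] labels[OF that(2), of "[]"] that(3) by simp
  have separated: "?run (W (i, r)) \<noteq> ?run (W (i, r'))"
    if P: "(i, r) \<in> ?P" "(i, r') \<in> ?P" and "r < r'" for i r r'
  proof -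
    have i: "i \<in> vstates A"
      using P by (simp add: phase_expanded_def)
    then obtain j b where jb: "j \<in> Out A i - {i}" "b \<in> inputs A" "guard A i b = label A j"
      using depart by blast
    have "replicate (Suc r) b \<in> lists (inputs A)"
      using jb(2) by auto
    then show ?thesis
      using phases_separated[OF sys i jb(1,3) \<open>r < r'\<close>] labels P by metis
  qed
  have "inj_on (\<lambda>p. ?run (W p)) ?P"
  proof (rule inj_onI)
    fix p p'
    assume P: "p \<in> ?P" "p' \<in> ?P" and run: "?run (W p) = ?run (W p')"
    obtain i r i' r' where [simp]: "p = (i, r)" "p' = (i', r')"
      by (metis surj_pair)
    have [simp]: "i' = i"
      using same_visible P run by simp
    have "r = r'"
      using separated[of i r r'] separated[of i r' r] P run
      by (cases r r' rule: linorder_cases) auto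
    then show "p = p'"
      by simp
  qed
  moreover have "(\<lambda>p. ?run (W p)) ` ?P \<subseteq> control T"
    using graph_respecting_run_in_control[OF gr] W(1) gr by (auto simp: graph_respecting_def)
  ultimately have "card ?P \<le> card (control T)"
    using card_inj_on_le True by blast
  \<comment> \<open>The count is a proper \<open>enat\<close>, which rules out the infinite branch
    of \<open>num_control\<close>.\<close>
  moreover have "finite ?P"
    using num_control_phase_expanded[OF sys] by (auto simp: num_control_def split: if_splits)
  ultimately show ?thesis
    using True by (simp add: num_control_def)
qed (simp add: num_control_def)

theorem corollary4p4:
  fixes A :: "('s, 'a, 'u) dlsl"
  assumes "dlsl_system A"
    and "finite (inputs A)"
    and "destination_complete A"
    and "\<forall>i \<in> vstates A. reachable A i"
    and "\<forall>i \<in> vstates A. \<exists>j \<in> Out A i - {i}. \<exists>b \<in> inputs A. guard A i b = label A j"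
  shows "realizes (phase_expanded A) A \<and>
         (\<forall>T :: ('q, 'u, 's) transducer.
            realizes T A \<longrightarrow> num_control (phase_expanded A) \<le> num_control T) \<and>
         num_control (phase_expanded A) = enat (\<Sum>i \<in> vstates A. dwell A i) \<and>
         min_control A = enat (\<Sum>i \<in> vstates A. dwell A i)"
proof -
  note real = realizes_phase_expanded[OF assms(1)]
  note num = num_control_phase_expanded[OF assms(1)]
  \<comment> \<open>The control type of \<open>T\<close> stays schematic here: the bound is used
    both at \<open>'q\<close> and at the type \<open>'s \<times> nat\<close> over which
    \<open>min_control\<close> ranges, which is also the type of the phase-expanded witness.\<close>
  note lower = num_control_phase_expanded_le[OF assms(1,3,4,5)]
  have "min_control A = enat (\<Sum>i \<in> vstates A. dwell A i)"
    unfolding min_control_def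
  proof (rule Least_equality)
    show "\<exists>T :: ('s \<times> nat, 'u, 's) transducer.
        realizes T A \<and> num_control T = enat (\<Sum>i \<in> vstates A. dwell A i)"
      using real num by blast
  next
    fix n
    assume "\<exists>T :: ('s \<times> nat, 'u, 's) transducer. realizes T A \<and> num_control T = n"
    then show "enat (\<Sum>i \<in> vstates A. dwell A i) \<le> n"
      using lower num by metis
  qed
  then show ?thesis
    using real num lower by blast
qed

end
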